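(* Let $G$ be a finite group and $H$ a non-trivial normal subgroup of $G$. Let $\kappa$ and $\tau$ be integers satisfying $0\leq\kappa\leq|H|-1$, $1\leq\tau\leq|H|$ and $\gcd(2,|H|-1)\mid\kappa$. Then: (i) if $\tau$ is even, then $H$ is a $(\kappa,\tau)$-regular set of $G$; (ii) if $\tau$ is odd, then $H$ is a $(\kappa,\tau)$-regular set of $G$ if and only if $H$ is a perfect code of $G$.
   Context: All graphs are finite, undirected and simple. For a finite group $G$ and an inverse-closed subset $X\subseteq G\setminus\{1\}$, the Cayley graph $\mathrm{Cay}(G,X)$ has vertex set $G$ and edge set $\{\{g,gx\}: g\in G, x\in X\}$. For nonnegative integers $\kappa,\tau$, a subset $R$ of the vertex set of a graph $\Gamma$ is a $(\kappa,\tau)$-regular set of $\Gamma$ if every vertex in $R$ is adjacent to exactly $\kappa$ vertices of $R$ and every vertex outside $R$ is adjacent to exactly $\tau$ vertices of $R$. A subset $R\subseteq G$ is a $(\kappa,\tau)$-regular set of $G$ if there is a Cayley graph $\Gamma$ on $G$ such that $R$ is a $(\kappa,\tau)$-regular set of $\Gamma$. A perfect code of $G$ here means a $(0,1)$-regular set of $G$ (equivalently, a subset $C$ of $G$ such that there is an inverse-closed subset $Y\ni 1$ of $G$ with every $g\in G$ expressible uniquely as $g=cy$ with $c\in C$, $y\in Y$). *)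

theory Defs
  imports "HOL-Algebra.Coset" "Graph_Theory.Pair_Digraph"
begin

text \<open>
  Undirected graphs are symmetric digraphs, as in \<open>Graph_Theory\<close>: the edge \<open>{u, v}\<close> is the pair of
  arcs \<open>(u, v)\<close> and \<open>(v, u)\<close>, and finite simple graphs are the instances of the locale
  \<^locale>\<open>graph\<close> (\<^locale>\<open>pair_graph\<close> when arcs are given as pairs of vertices).
\<close>

definition cayley_connection_set :: "('a, 'b) monoid_scheme \<Rightarrow> 'a set \<Rightarrow> bool" where
  "cayley_connection_set G X \<longleftrightarrow>
     X \<subseteq> carrier G - {\<one>\<^bsub>G\<^esub>} \<and> (\<forall>x\<in>X. inv\<^bsub>G\<^esub> x \<in> X)"

definition cayley_graph :: "('a, 'b) monoid_scheme \<Rightarrow> 'a set \<Rightarrow> 'a pair_pre_digraph" where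
  "cayley_graph G X =
     \<lparr>pverts = carrier G, parcs = {(g, g \<otimes>\<^bsub>G\<^esub> x) | g x. g \<in> carrier G \<and> x \<in> X}\<rparr>"

definition regular_set :: "('v, 'e) pre_digraph \<Rightarrow> nat \<Rightarrow> nat \<Rightarrow> 'v set \<Rightarrow> bool" where
  "regular_set \<Gamma> \<kappa> \<tau> R \<longleftrightarrow>
     R \<subseteq> verts \<Gamma> \<and>
     (\<forall>v\<in>R. card {u \<in> R. (v, u) \<in> arcs_ends \<Gamma>} = \<kappa>) \<and>
     (\<forall>v\<in>verts \<Gamma> - R. card {u \<in> R. (v, u) \<in> arcs_ends \<Gamma>} = \<tau>)"

definition group_regular_set :: "('a, 'b) monoid_scheme \<Rightarrow> nat \<Rightarrow> nat \<Rightarrow> 'a set \<Rightarrow> bool" where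
  "group_regular_set G \<kappa> \<tau> R \<longleftrightarrow>
     (\<exists>X. cayley_connection_set G X \<and> regular_set (with_proj (cayley_graph G X)) \<kappa> \<tau> R)"

definition group_perfect_code :: "('a, 'b) monoid_scheme \<Rightarrow> 'a set \<Rightarrow> bool" where
  "group_perfect_code G C \<longleftrightarrow> group_regular_set G 0 1 C"

lemma pair_graph_cayley_graph:
  assumes "group G" "finite (carrier G)" "cayley_connection_set G X"
  shows "pair_graph (cayley_graph G X)"
proof -
  interpret group G by fact
  have X: "x \<in> carrier G" "x \<noteq> \<one>\<^bsub>G\<^esub>" "inv\<^bsub>G\<^esub> x \<in> X" if "x \<in> X" for x
    using assms(3) that by (auto simp: cayley_connection_set_def)
  have arcs: "parcs (cayley_graph G X) \<subseteq> carrier G \<times> carrier G"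
    by (auto simp: cayley_graph_def X)
  have symm: "(v, u) \<in> parcs (cayley_graph G X)" if uv: "(u, v) \<in> parcs (cayley_graph G X)" for u v
  proof -
    obtain x where x: "u \<in> carrier G" "x \<in> X" "v = u \<otimes>\<^bsub>G\<^esub> x"
      using uv by (auto simp: cayley_graph_def)
    then have "v \<in> carrier G" "u = v \<otimes>\<^bsub>G\<^esub> inv\<^bsub>G\<^esub> x"
      by (auto simp: X m_assoc)
    then show ?thesis
      using X(3)[OF x(2)] by (auto simp: cayley_graph_def)
  qed
  have verts: "pverts (cayley_graph G X) = carrier G"
    by (simp add: cayley_graph_def)
  show ?thesis
  proof
    show "finite (pverts (cayley_graph G X))" "finite (parcs (cayley_graph G X))"
      using assms(2) arcs by (auto simp: verts intro: finite_subset)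
    show "fst e \<in> pverts (cayley_graph G X)" "snd e \<in> pverts (cayley_graph G X)"
      if "e \<in> parcs (cayley_graph G X)" for e
      using that arcs by (auto simp: verts)
    show "fst e \<noteq> snd e" if "e \<in> parcs (cayley_graph G X)" for e
      using that by (auto simp: cayley_graph_def X)
    show "symmetric (with_proj (cayley_graph G X))"
      using symm by (auto simp: symmetric_def arcs_ends_conv sym_def)
  qed
qed

lemma cayley_graph_edges:
  "{{u, v} | u v. (u, v) \<in> arcs_ends (with_proj (cayley_graph G X))} =
   {{g, g \<otimes>\<^bsub>G\<^esub> x} | g x. g \<in> carrier G \<and> x \<in> X}"
  by (auto simp: cayley_graph_def arcs_ends_conv)

end

theory Submission
  imports Defs
begin

text \<open>
  For normal \<open>H\<close>, the graph \<open>Cay(G, X)\<close> has \<open>H\<close> as a \<open>(\<kappa>, \<tau>)\<close>-regular set iff \<open>X\<close> meets \<open>H\<close> in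
  \<open>\<kappa>\<close> elements and every other coset in \<open>\<tau>\<close> elements. So the question is which cosets contain
  inverse-closed subsets of prescribed size. Inversion either swaps two cosets, where there is no
  constraint, or acts on a single coset as an involution; there every even size is available, and
  an odd size is available iff the coset contains an element equal to its own inverse. That
  last condition does not depend on the odd number \<open>\<tau>\<close>, so it can be tested at \<open>\<tau> = 1\<close>.
\<close>

section \<open>Involutions on finite sets\<close>

text \<open>Discarding a two-element orbit \<open>{a, f a}\<close> keeps the cardinality odd, so the
  set cannot be exhausted before a fixed point turns up.\<close>

lemma involution_odd_card_fixpoint:
  assumes "finite S" "odd (card S)" "\<And>x. x \<in> S \<Longrightarrow> f x \<in> S" "\<And>x. x \<in> S \<Longrightarrow> f (f x) = x"
  shows "\<exists>x\<in>S. f x = x"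
  using assms
proof (induction S rule: finite_psubset_induct)
  case (psubset S)
  from psubset.prems(1) obtain a where a: "a \<in> S"
    by fastforce
  show ?case
  proof (cases "f a = a")
    case False
    let ?T = "S - {a, f a}"
    have "card ?T = card S - 2"
      using a False psubset.prems(2)[OF a] by (subst card_Diff_subset) auto
    \<comment> \<open>This rules out truncation in \<open>card S - 2\<close>, so parity is really
      preserved.\<close>
    moreover have "card {a, f a} \<le> card S"
      using psubset a by (intro card_mono) auto
    ultimately have "odd (card ?T)"
      using psubset.prems(1) False by auto
    moreover have "f x \<in> ?T" if "x \<in> ?T" for x
      using that psubset.prems(2,3) a by auto metis+
    ultimately have "\<exists>x\<in>?T. f x = x"
      using psubset.prems(3) a by (intro psubset.IH) auto
    then show ?thesis by blast
  qed (use a in blast)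
qed

text \<open>Closed subsets are unions of orbits of size 1 or 2. The induction puts a whole orbit
  \<open>{a, f a}\<close> into \<open>T\<close> and lowers \<open>t\<close> by 2; parity is
  unchanged, and any fixed point survives because neither \<open>a\<close> nor \<open>f a\<close> is
  one.\<close>

lemma involution_closed_subset_card:
  assumes "finite S" "\<And>x. x \<in> S \<Longrightarrow> f x \<in> S" "\<And>x. x \<in> S \<Longrightarrow> f (f x) = x"
    and "t \<le> card S" "even t \<or> (\<exists>x\<in>S. f x = x)"
  shows "\<exists>T\<subseteq>S. f ` T \<subseteq> T \<and> card T = t"
  using assms
proof (induction S arbitrary: t rule: finite_psubset_induct)
  case (psubset S)
  consider "\<forall>x\<in>S. f x = x" | "t = 0" | "t = 1"
    | a where "a \<in> S" "f a \<noteq> a" "2 \<le> t"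
    by fastforce
  then show ?case
  proof cases
    case 1
    obtain T where "T \<subseteq> S" "card T = t"
      using psubset.prems(3) by (meson obtain_subset_with_card_n)
    then show ?thesis
      using 1 by (intro exI[of _ T]) auto
  next
    case 2
    then show ?thesis
      by (intro exI[of _ "{}"]) auto
  next
    case 3
    then obtain x where "x \<in> S" "f x = x"
      using psubset.prems(4) by auto
    then show ?thesis
      using 3 by (intro exI[of _ "{x}"]) auto
  next
    case 4
    let ?S = "S - {a, f a}"
    note fS = psubset.prems(1,2)
    have cS: "card ?S = card S - 2"
      using 4 fS(1)[OF 4(1)] by (subst card_Diff_subset) auto
    have clS: "f x \<in> ?S" if "x \<in> ?S" for x
      using that fS 4 by auto metis+
    have "\<exists>T\<subseteq>?S. f ` T \<subseteq> T \<and> card T = t - 2"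
    proof (rule psubset.IH)
      show "t - 2 \<le> card ?S"
        using cS psubset.prems(3) by simp
      show "even (t - 2) \<or> (\<exists>x\<in>?S. f x = x)"
        using psubset.prems(4) 4 fS by auto
    qed (use 4 fS clS in auto)
    then obtain T where T: "T \<subseteq> ?S" "f ` T \<subseteq> T" "card T = t - 2"
      by blast
    have "finite T"
      using T(1) psubset.hyps by (meson finite_Diff finite_subset)
    then have "card (insert a (insert (f a) T)) = t"
      using T 4 by (subst card_insert_disjoint; auto)+
    then show ?thesis
      using T 4 fS by (intro exI[of _ "insert a (insert (f a) T)"]) auto
  qed
qed

text \<open>By the hypothesis on \<open>K\<close>, the involution permutes the fibres of
  \<open>K\<close>, each orbit consisting of one or two fibres. The orbits can be treated
  independently, and the induction removes one at a time. In the application \<open>f\<close> is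
  inversion and \<open>K\<close> sends an element to its coset.\<close>

lemma involution_closed_subset_prescribed_fibres:
  fixes f :: "'a \<Rightarrow> 'a" and K :: "'a \<Rightarrow> 'b" and m :: "'b \<Rightarrow> nat"
  assumes "finite A" "\<And>x. x \<in> A \<Longrightarrow> f x \<in> A" "\<And>x. x \<in> A \<Longrightarrow> f (f x) = x"
    and "\<And>x y. x \<in> A \<Longrightarrow> y \<in> A \<Longrightarrow> K x = K y \<Longrightarrow> K (f x) = K (f y)"
    and "\<And>x. x \<in> A \<Longrightarrow> m (K (f x)) = m (K x)"
    and "\<And>x. x \<in> A \<Longrightarrow> m (K x) \<le> card {y \<in> A. K y = K x}"
    and "\<And>x. x \<in> A \<Longrightarrow> K (f x) = K x \<Longrightarrow> even (m (K x)) \<or> (\<exists>y\<in>A. K y = K x \<and> f y = y)"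
  shows "\<exists>X\<subseteq>A. f ` X \<subseteq> X \<and> (\<forall>x\<in>A. card {y \<in> X. K y = K x} = m (K x))"
  using assms
proof (induction A rule: finite_psubset_induct)
  case (psubset A)
  note fA = psubset.prems(1,2) and Kf = psubset.prems(3) and mf = psubset.prems(4)
    and le = psubset.prems(5) and fp = psubset.prems(6)
  show ?case
  proof (cases "A = {}")
    case False
    then obtain a where a: "a \<in> A" by blast
    define F where "F c = {y \<in> A. K y = c}" for c
    \<comment> \<open>The orbit of the fibre of \<open>a\<close>: \<open>f\<close> maps
      \<open>F (K (f a))\<close> back to \<open>F (K a)\<close> since
      \<open>f (f a) = a\<close>.\<close>
    define B where "B = F (K a) \<union> F (K (f a))"
    have finF: "finite (F c)" for c
      using psubset.hyps by (simp add: F_def)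
    have f_F: "f x \<in> F (K (f y))" if "y \<in> A" "x \<in> F (K y)" for x y
      using that Kf[of x y] fA(1) by (auto simp: F_def)
    have fB: "f x \<in> B" if "x \<in> B" for x
      using that f_F[OF a, of x] f_F[OF fA(1)[OF a], of x] by (auto simp: B_def fA(2)[OF a])
    have F_split: "{y \<in> A - B. K y = K x} = {y \<in> A. K y = K x}" if "x \<in> A - B" for x
      using that by (auto simp: B_def F_def)
    have "\<exists>X\<subseteq>A - B. f ` X \<subseteq> X \<and> (\<forall>x\<in>A - B. card {y \<in> X. K y = K x} = m (K x))"
    proof (rule psubset.IH)
      show "A - B \<subset> A"
        using a by (auto simp: B_def F_def)
      show "f x \<in> A - B" if "x \<in> A - B" for x
        using that fA fB[of "f x"] by auto
      show "m (K x) \<le> card {y \<in> A - B. K y = K x}" if "x \<in> A - B" for x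
        using that le[of x] F_split[OF that] by simp
      show "even (m (K x)) \<or> (\<exists>y\<in>A - B. K y = K x \<and> f y = y)"
        if "x \<in> A - B" "K (f x) = K x" for x
      proof -
        have "even (m (K x)) \<or> (\<exists>y\<in>{y \<in> A. K y = K x}. f y = y)"
          using that fp[of x] by auto
        then show ?thesis
          unfolding F_split[OF that(1), symmetric] by auto
      qed
      show "K (f x) = K (f y)" if "x \<in> A - B" "y \<in> A - B" "K x = K y" for x y
        using that by (intro Kf) auto
    qed (use fA mf in auto)
    then obtain X where X: "X \<subseteq> A - B" "f ` X \<subseteq> X"
      "\<forall>x\<in>A - B. card {y \<in> X. K y = K x} = m (K x)"
      by (elim exE conjE) (rule that)
    \<comment> \<open>Both counts may be written \<open>m (K a)\<close> because \<open>m\<close>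
      takes the same value on the two fibres.\<close>
    have "\<exists>Y\<subseteq>B. f ` Y \<subseteq> Y \<and> card (Y \<inter> F (K a)) = m (K a) \<and> card (Y \<inter> F (K (f a))) = m (K a)"
    proof (cases "K (f a) = K a")
      case True
      have "\<exists>Y\<subseteq>F (K a). f ` Y \<subseteq> Y \<and> card Y = m (K a)"
      proof (rule involution_closed_subset_card)
        show "f x \<in> F (K a)" if "x \<in> F (K a)" for x
          using f_F[OF a that] True by simp
        show "even (m (K a)) \<or> (\<exists>x\<in>F (K a). f x = x)"
          using fp[OF a True] by (auto simp: F_def)
      qed (use finF fA le[OF a] in \<open>auto simp: F_def\<close>)
      then show ?thesis
        using True by (metis B_def Int_absorb2 sup_idem)
    next
      \<comment> \<open>For two swapped fibres, any \<open>Y\<close> of the right size in one is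
        completed by its image in the other, whatever the parity.\<close>
      case False
      obtain Y where Y: "Y \<subseteq> F (K a)" "card Y = m (K a)"
        using le[OF a] unfolding F_def by (meson obtain_subset_with_card_n)
      have YA: "Y \<subseteq> A"
        using Y by (auto simp: F_def)
      have fY: "f ` Y \<subseteq> F (K (f a))"
        using f_F[OF a] Y by blast
      have disj: "F (K a) \<inter> F (K (f a)) = {}"
        using False by (auto simp: F_def)
      have "inj_on f Y"
        using fA YA by (metis inj_onI subsetD)
      then have "card (f ` Y) = m (K a)"
        using Y by (simp add: card_image)
      moreover have "(Y \<union> f ` Y) \<inter> F (K a) = Y" "(Y \<union> f ` Y) \<inter> F (K (f a)) = f ` Y"
        using Y fY disj by blast+
      moreover have "f ` (Y \<union> f ` Y) \<subseteq> Y \<union> f ` Y"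
        using fA YA by auto
      moreover have "Y \<union> f ` Y \<subseteq> B"
        using Y fY by (auto simp: B_def)
      ultimately show ?thesis
        using Y by (intro exI[of _ "Y \<union> f ` Y"]) simp
    qed
    then obtain Y where Y: "Y \<subseteq> B" "f ` Y \<subseteq> Y"
      "card (Y \<inter> F (K a)) = m (K a)" "card (Y \<inter> F (K (f a))) = m (K a)"
      by blast
    have BA: "B \<subseteq> A"
      by (auto simp: B_def F_def)
    \<comment> \<open>Since \<open>B\<close> is a union of whole fibres, each fibre meets only one
      of \<open>X\<close> and \<open>Y\<close>.\<close>
    have "card {y \<in> X \<union> Y. K y = K x} = m (K x)" if x: "x \<in> A" for x
    proof (cases "x \<in> B")
      case True
      then have "F (K x) \<subseteq> B"
        by (auto simp: B_def F_def)
      then have "{y \<in> X \<union> Y. K y = K x} = Y \<inter> F (K x)"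
        using X(1) Y(1) BA by (auto simp: F_def)
      moreover have "card (Y \<inter> F (K x)) = m (K x)"
        using True Y mf[OF a] by (auto simp: B_def F_def)
      ultimately show ?thesis by simp
    next
      case False
      then have "{y \<in> X \<union> Y. K y = K x} = {y \<in> X. K y = K x}"
        using x Y(1) by (auto simp: B_def F_def)
      then show ?thesis
        using X(3) x False by simp
    qed
    moreover have "X \<union> Y \<subseteq> A" "f ` (X \<union> Y) \<subseteq> X \<union> Y"
      using X Y BA by auto
    ultimately show ?thesis by blast
  qed simp
qed

section \<open>Cosets of a normal subgroup and neighbour counts\<close>

context normal
begin

lemma rcos_eq_iff:
  assumes "x \<in> carrier G" "y \<in> carrier G"
  shows "H #> x = H #> y \<longleftrightarrow> x \<in> H #> y"
  using repr_independence[OF _ assms(2) subgroup_axioms] rcos_self[OF assms(1) subgroup_axioms]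
  by blast

lemma rcos_eq_self_iff:
  assumes "x \<in> carrier G"
  shows "H #> x = H \<longleftrightarrow> x \<in> H"
  using rcos_eq_iff[OF assms one_closed] coset_mult_one[OF subset] by simp

lemma inv_mem_iff:
  assumes "x \<in> carrier G"
  shows "inv x \<in> H \<longleftrightarrow> x \<in> H"
  using assms by (metis inv_inv m_inv_closed)

text \<open>The products \<open>v \<otimes> x\<close> and \<open>x \<otimes> v\<close> are conjugate
  by \<open>v\<close>, so normality puts both or neither in \<open>H\<close>; the second lies in
  \<open>H\<close> exactly when \<open>x\<close> is in the right coset of
  \<open>inv v\<close>.\<close>

lemma mult_mem_iff_rcos_eq:
  assumes "v \<in> carrier G" "x \<in> carrier G"
  shows "v \<otimes> x \<in> H \<longleftrightarrow> H #> x = H #> inv v"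
proof -
  have "v \<otimes> x \<in> H \<longleftrightarrow> H #> (v \<otimes> x) = H"
    using assms by (simp add: rcos_eq_self_iff)
  also have "\<dots> \<longleftrightarrow> x \<otimes> v \<in> H"
  proof -
    have "x \<otimes> v = inv v \<otimes> (v \<otimes> x) \<otimes> v" "v \<otimes> x = v \<otimes> (x \<otimes> v) \<otimes> inv v"
      using assms by (simp_all add: m_assoc inv_solve_left)
    then show ?thesis
      using assms inv_op_closed1 inv_op_closed2 by (metis m_closed rcos_eq_self_iff)
  qed
  also have "\<dots> \<longleftrightarrow> x \<in> H #> inv v"
  proof
    assume "x \<otimes> v \<in> H"
    then have "x \<otimes> v \<otimes> inv v \<in> H #> inv v"
      using assms by (intro rcosI subset) auto
    then show "x \<in> H #> inv v"
      using assms by (simp add: m_assoc)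
  next
    assume "x \<in> H #> inv v"
    then obtain h where "h \<in> H" "x = h \<otimes> inv v"
      by (auto simp: r_coset_def)
    then show "x \<otimes> v \<in> H"
      using assms by (simp add: m_assoc)
  qed
  finally show ?thesis
    using assms by (simp add: rcos_eq_iff)
qed

text \<open>Left multiplication by \<open>v\<close> carries the elements of \<open>X\<close> in the
  coset of \<open>inv v\<close> bijectively to the neighbours of \<open>v\<close> in
  \<open>H\<close>. Replacing \<open>v\<close> by its inverse permutes the group and preserves
  membership in \<open>H\<close>.\<close>

lemma regular_set_cayley_graph_iff:
  assumes X: "X \<subseteq> carrier G"
  shows "regular_set (with_proj (cayley_graph G X)) \<kappa> \<tau> H \<longleftrightarrow>
    (\<forall>v\<in>carrier G. card {x \<in> X. H #> x = H #> v} = (if v \<in> H then \<kappa> else \<tau>))"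
proof -
  have card_nbrs: "card {u \<in> H. (v, u) \<in> arcs_ends (with_proj (cayley_graph G X))} =
      card {x \<in> X. H #> x = H #> inv v}" if v: "v \<in> carrier G" for v
  proof -
    have "{u \<in> H. (v, u) \<in> arcs_ends (with_proj (cayley_graph G X))} =
        (\<lambda>x. v \<otimes> x) ` {x \<in> X. v \<otimes> x \<in> H}"
      using v by (auto simp: arcs_ends_conv cayley_graph_def)
    moreover have "inj_on (\<lambda>x. v \<otimes> x) {x \<in> X. v \<otimes> x \<in> H}"
      using v X by (auto intro!: inj_onI simp: subset_iff)
    moreover have "{x \<in> X. v \<otimes> x \<in> H} = {x \<in> X. H #> x = H #> inv v}"
      using v X mult_mem_iff_rcos_eq by blast
    ultimately show ?thesis
      by (simp add: card_image)
  qed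
  have "regular_set (with_proj (cayley_graph G X)) \<kappa> \<tau> H \<longleftrightarrow>
      (\<forall>v\<in>carrier G. card {x \<in> X. H #> x = H #> inv v} = (if v \<in> H then \<kappa> else \<tau>))"
    using subset card_nbrs by (auto simp: regular_set_def cayley_graph_def)
  also have "\<dots> \<longleftrightarrow> (\<forall>v\<in>carrier G. card {x \<in> X. H #> x = H #> v} = (if v \<in> H then \<kappa> else \<tau>))"
  proof -
    have "(\<forall>v\<in>carrier G. P (inv v)) \<longleftrightarrow> (\<forall>v\<in>carrier G. P v)" for P
      by (metis inv_closed inv_inv)
    from this[of "\<lambda>v. card {x \<in> X. H #> x = H #> v} = (if v \<in> H then \<kappa> else \<tau>)"]
    show ?thesis
      by (simp add: inv_mem_iff cong: ball_cong)
  qed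
  finally show ?thesis .
qed

section \<open>Regular sets and self-inverse coset representatives\<close>

text \<open>Inversion acts on the part of \<open>X\<close> in the coset of \<open>g\<close>, which
  has the odd size \<open>\<tau>\<close>. The conclusion mentions neither \<open>\<kappa>\<close>
  nor \<open>\<tau>\<close>, which is what lets regularity be transferred between different
  parameters.\<close>

lemma group_regular_set_odd_imp_fixpoint:
  assumes fin: "finite (carrier G)" and reg: "group_regular_set G \<kappa> \<tau> H" and "odd \<tau>"
    and g: "g \<in> carrier G - H" "H #> inv g = H #> g"
  shows "\<exists>y\<in>H #> g. inv y = y"
proof -
  obtain X where X: "cayley_connection_set G X" "regular_set (with_proj (cayley_graph G X)) \<kappa> \<tau> H"
    using reg by (auto simp: group_regular_set_def)
  then have XG: "X \<subseteq> carrier G" and Xinv: "\<And>x. x \<in> X \<Longrightarrow> inv x \<in> X"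
    by (auto simp: cayley_connection_set_def)
  let ?S = "{x \<in> X. H #> x = H #> g}"
  have "card ?S = \<tau>"
    using X(2) g unfolding regular_set_cayley_graph_iff[OF XG] by auto
  moreover have "H #> inv x = H #> g" if "x \<in> ?S" for x
    using that XG g rcos_inv by (metis (mono_tags, lifting) DiffD1 mem_Collect_eq subsetD)
  ultimately have "\<exists>x\<in>?S. inv x = x"
    using \<open>odd \<tau>\<close> fin XG Xinv
    by (intro involution_odd_card_fixpoint) (auto intro: finite_subset)
  then show ?thesis
    using XG g rcos_eq_iff by blast
qed

lemma group_regular_setI:
  assumes fin: "finite (carrier G)"
    and \<kappa>: "\<kappa> \<le> card H - 1" "gcd 2 (card H - 1) dvd \<kappa>"
    and \<tau>: "\<tau> \<le> card H"
    and fixp: "\<And>g. g \<in> carrier G - H \<Longrightarrow> H #> inv g = H #> g \<Longrightarrow>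
      even \<tau> \<or> (\<exists>y\<in>H #> g. inv y = y)"
  shows "group_regular_set G \<kappa> \<tau> H"
proof -
  let ?A = "carrier G - {\<one>}"
  \<comment> \<open>The size that the connection set must have in each coset.\<close>
  define m where "m C = (if C = H then \<kappa> else \<tau>)" for C
  have m_rcos: "m (H #> x) = (if x \<in> H then \<kappa> else \<tau>)" if "x \<in> carrier G" for x
    using that by (simp add: m_def rcos_eq_self_iff)
  \<comment> \<open>Only the coset \<open>H\<close> loses an element to the exclusion of the
    identity, whence the bound \<open>card H - 1\<close> for \<open>\<kappa>\<close> against
    \<open>card H\<close> for \<open>\<tau>\<close>.\<close>
  have fibre: "{y \<in> ?A. H #> y = H #> x} = (if x \<in> H then H - {\<one>} else H #> x)"
    if x: "x \<in> carrier G" for x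
  proof -
    have "{y \<in> carrier G. H #> y = H #> x} = H #> x"
      using x rcos_eq_iff r_coset_subset_G[OF subset x] by blast
    moreover have "H #> x = H" if "x \<in> H"
      using x that by (simp add: rcos_eq_self_iff)
    moreover have "\<one> \<notin> H #> x" if "x \<notin> H"
      using x that rcos_eq_iff[OF one_closed x] coset_mult_one[OF subset] rcos_eq_self_iff[OF x]
      by metis
    ultimately show ?thesis by auto
  qed
  have finH: "finite H"
    using fin subset by (rule rev_finite_subset)
  \<comment> \<open>If \<open>card H - 1\<close> is odd, inversion fixes some element of
    \<open>H - {\<one>}\<close>; otherwise the gcd is 2 and forces \<open>\<kappa>\<close> to be
    even.\<close>
  have H1: "even \<kappa> \<or> (\<exists>y\<in>H - {\<one>}. inv y = y)"
  proof (cases "odd (card H - 1)")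
    case True
    have "\<exists>y\<in>H - {\<one>}. inv y = y"
    proof (rule involution_odd_card_fixpoint)
      show "odd (card (H - {\<one>}))"
        using True by simp
    qed (use finH in auto)
    then show ?thesis ..
  next
    case False
    then show ?thesis
      using \<kappa>(2) by (simp add: gcd_nat.absorb1)
  qed
  have "\<exists>X\<subseteq>?A. m_inv G ` X \<subseteq> X \<and> (\<forall>x\<in>?A. card {y \<in> X. H #> y = H #> x} = m (H #> x))"
  proof (rule involution_closed_subset_prescribed_fibres)
    show "H #> inv x = H #> inv y" if "x \<in> ?A" "y \<in> ?A" "H #> x = H #> y" for x y
      using that rcos_inv by (metis DiffD1)
    show "m (H #> inv x) = m (H #> x)" if "x \<in> ?A" for x
      using that inv_mem_iff by (simp add: m_rcos)
    show "m (H #> x) \<le> card {y \<in> ?A. H #> y = H #> x}" if "x \<in> ?A" for x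
    proof -
      have "card (H #> x) = card H"
        using that card_rcosets_equal[OF rcosetsI[OF subset]] subset by auto
      then show ?thesis
        using that \<kappa>(1) \<tau> fibre[of x] by (cases "x \<in> H") (simp_all add: m_rcos)
    qed
    show "even (m (H #> x)) \<or> (\<exists>y\<in>?A. H #> y = H #> x \<and> inv y = y)"
      if x: "x \<in> ?A" "H #> inv x = H #> x" for x
    proof -
      have "even (m (H #> x)) \<or> (\<exists>y\<in>{y \<in> ?A. H #> y = H #> x}. inv y = y)"
        using x H1 fixp[of x] fibre[of x] by (cases "x \<in> H") (simp_all add: m_rcos)
      then show ?thesis by auto
    qed
  qed (use fin in auto)
  then obtain X where X: "X \<subseteq> ?A" "m_inv G ` X \<subseteq> X"
    "\<forall>x\<in>?A. card {y \<in> X. H #> y = H #> x} = m (H #> x)"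
    by (elim exE conjE) (rule that)
  have "card {x \<in> X. H #> x = H #> v} = (if v \<in> H then \<kappa> else \<tau>)" if v: "v \<in> carrier G" for v
  proof (cases "v \<in> ?A")
    case True
    then show ?thesis
      using X(3) v by (simp add: m_rcos)
  next
    case False
    then have "v = \<one>"
      using v by simp
    show ?thesis
    \<comment> \<open>The fibre counts are known only at non-identity elements. At the identity the
      count is read off from another element of \<open>H\<close>; if there is none, then
      \<open>card H - 1 = 0\<close> and hence \<open>\<kappa> = 0\<close>.\<close>
    proof (cases "H = {\<one>}")
      case True
      have "{x \<in> X. H #> x = H #> v} \<subseteq> {y \<in> ?A. H #> y = H #> v}"
        using X(1) by blast
      also have "\<dots> = {}"
        using True \<open>v = \<one>\<close> by (subst fibre[OF v]) simp
      finally have "card {x \<in> X. H #> x = H #> v} = 0"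
        by (simp only: subset_empty card.empty)
      moreover have "\<kappa> = 0"
        using True \<kappa>(1) by simp
      ultimately show ?thesis
        using True \<open>v = \<one>\<close> by simp
    next
      case False
      then obtain h where "h \<in> H" "h \<noteq> \<one>"
        using subgroup.one_closed[OF subgroup_axioms] by blast
      then have "h \<in> ?A" "H #> h = H #> v"
        using \<open>v = \<one>\<close> by (simp_all add: rcos_eq_self_iff coset_mult_one[OF subset])
      then show ?thesis
        using X(3)[rule_format, of h] v by (simp add: m_rcos)
    qed
  qed
  moreover have "X \<subseteq> carrier G" "cayley_connection_set G X"
    using X by (auto simp: cayley_connection_set_def)
  ultimately show ?thesis
    by (auto simp: group_regular_set_def regular_set_cayley_graph_iff)
qed

end

theorem theorem1p1:
  fixes G (structure) and H :: "'a set" and \<kappa> \<tau> :: nat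
  assumes "group G"
    and "finite (carrier G)"
    and "H \<lhd> G"
    and "H \<noteq> {\<one>}"
    and "0 \<le> \<kappa>" and "\<kappa> \<le> card H - 1"
    and "1 \<le> \<tau>" and "\<tau> \<le> card H"
    and "gcd 2 (card H - 1) dvd \<kappa>"
  shows "(even \<tau> \<longrightarrow> group_regular_set G \<kappa> \<tau> H) \<and>
    (odd \<tau> \<longrightarrow> (group_regular_set G \<kappa> \<tau> H \<longleftrightarrow> group_perfect_code G H))"
proof -
  interpret normal H G by fact
  have "group_regular_set G \<kappa> \<tau> H" if "even \<tau>"
    using assms that by (intro group_regular_setI) auto
  \<comment> \<open>Regularity with one odd parameter \<open>t\<close> supplies a self-inverse
    element in every self-inverse coset outside \<open>H\<close>, enough for all admissible
    \<open>\<kappa>'\<close> and \<open>\<tau>'\<close>. It is used from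
    \<open>(\<kappa>, \<tau>)\<close> to \<open>(0, 1)\<close> and back.\<close>
  moreover have "group_regular_set G \<kappa>' \<tau>' H"
    if "group_regular_set G k t H" "odd t"
      "\<kappa>' \<le> card H - 1" "gcd 2 (card H - 1) dvd \<kappa>'" "\<tau>' \<le> card H"
    for k t \<kappa>' \<tau>'
    using assms(2) that group_regular_set_odd_imp_fixpoint by (intro group_regular_setI) blast+
  ultimately show ?thesis
    using assms unfolding group_perfect_code_def
    by (metis dvd_0_right le0 odd_one order_trans)
qed

end
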